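(* Let $\bar S_n$ be the mean size of a semantic tree induced by a tree of size $n$, i.e. the arithmetic mean over all plane rooted trees $T$ of size $n$ of the number of nodes of $\mathrm{Sem}(T)$. Then, as $n\to\infty$, $$\bar S_n=e\sqrt{2\pi n}\left(\frac{n}{2e}\right)^n\left(2+\frac{2}{3n}+\frac{49}{36n^2}+\frac{27449}{6480n^3}+O\!\left(\frac1{n^4}\right)\right).$$
   Context: A syntax tree is a plane rooted tree, i.e. a rooted tree in which the children of each node are linearly ordered; its size is its number of nodes. The nodes of a given tree are regarded as carrying pairwise distinct names (actions), but trees are enumerated up to isomorphism of plane rooted trees (unlabelled). For a plane rooted tree $T$ whose root has children $v_1,\dots,v_r$ from left to right, and $1\le i\le r$, the $i$-contraction $T\lhd i$ is the plane tree with root $v_i$ whose root-subtrees are, from left to right, $T(v_1),\dots,T(v_{i-1}),T(v_{i_1}),\dots,T(v_{i_m}),T(v_{i+1}),\dots,T(v_r)$, where $T(v)$ is the subtree of all descendants of $v$ (including $v$) and $v_{i_1},\dots,v_{i_m}$ are the children of $v_i$ in order. The semantic tree $\mathrm{Sem}(T)$ is defined recursively: if $T$ is a single node, $\mathrm{Sem}(T)=T$; if $T$ has root $t$ with $r\ge1$ children, $\mathrm{Sem}(T)$ has root $t$ and root-subtrees $\mathrm{Sem}(T\lhd 1),\dots,\mathrm{Sem}(T\lhd r)$ from left to right. *)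

theory Defs
  imports Complex_Main "HOL-Library.Landau_Symbols"
begin

text \<open>
  Plane rooted trees whose nodes carry labels (the names of the actions).
  The elements of \<open>unit plane_tree\<close> are exactly the unlabelled plane rooted
  trees, i.e. the isomorphism types.
\<close>

datatype 'a plane_tree = Node 'a "'a plane_tree list"

fun nodes :: "'a plane_tree \<Rightarrow> nat" where
  "nodes (Node t ts) = Suc (\<Sum>u\<leftarrow>ts. nodes u)"

text \<open>Children are counted from 0, so \<open>contract T i\<close> is the \<open>(i + 1)\<close>-contraction of \<open>T\<close>.\<close>

fun contract :: "'a plane_tree \<Rightarrow> nat \<Rightarrow> 'a plane_tree" where
  "contract (Node t ts) i =
     (case ts ! i of Node v us \<Rightarrow> Node v (take i ts @ us @ drop (Suc i) ts))"

lemma nodes_contract: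
  assumes "i < length ts"
  shows "Suc (nodes (contract (Node t ts) i)) = nodes (Node t ts)"
proof -
  obtain v us where v: "ts ! i = Node v us"
    by (cases "ts ! i")
  have ts: "ts = take i ts @ Node v us # drop (Suc i) ts"
    using id_take_nth_drop[OF assms] v by simp
  have "(\<Sum>u\<leftarrow>ts. nodes u) = (\<Sum>u\<leftarrow>take i ts @ Node v us # drop (Suc i) ts. nodes u)"
    using ts by simp
  then show ?thesis
    using v by simp
qed

text \<open>The single-node case of the recursion is the instance \<open>ts = []\<close>.\<close>

function Sem :: "'a plane_tree \<Rightarrow> 'a plane_tree" where
  "Sem (Node t ts) = Node t (map (\<lambda>i. Sem (contract (Node t ts) i)) [0..<length ts])"
  by pat_completeness auto
termination
proof (relation "measure nodes")
  fix t :: 'a and ts :: "'a plane_tree list" and i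
  assume "i \<in> set [0..<length ts]"
  then have "Suc (nodes (contract (Node t ts) i)) = nodes (Node t ts)"
    by (intro nodes_contract) simp
  then show "(contract (Node t ts) i, Node t ts) \<in> measure nodes"
    by simp
qed simp

definition trees_of_size :: "nat \<Rightarrow> unit plane_tree set" where
  "trees_of_size n = {T. nodes T = n}"

definition mean_sem_size :: "nat \<Rightarrow> real" where
  "mean_sem_size n =
     (\<Sum>T\<in>trees_of_size n. real (nodes (Sem T))) / real (card (trees_of_size n))"

text \<open>For \<open>n \<ge> 1\<close> the sum and the cardinality above range over a finite nonempty set.\<close>

lemma nodes_pos: "nodes T > 0"
  by (cases T) simp

lemma length_le_sum_nodes: "length ts \<le> (\<Sum>u\<leftarrow>ts. nodes u)"
proof (induction ts)
  case (Cons a ts)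
  then show ?case
    using nodes_pos[of a] by simp
qed simp

lemma finite_nodes_le: "finite {T :: unit plane_tree. nodes T \<le> n}"
proof (induction n)
  case 0
  have "nodes T \<noteq> 0" for T :: "unit plane_tree"
    using nodes_pos[of T] by simp
  then have "{T :: unit plane_tree. nodes T \<le> 0} = {}"
    unfolding le_zero_eq by blast
  then show ?case
    by (simp only: finite.emptyI)
next
  case (Suc n)
  let ?A = "{T :: unit plane_tree. nodes T \<le> n}"
  have "T \<in> Node () ` {ts. set ts \<subseteq> ?A \<and> length ts \<le> n}"
    if T: "nodes T \<le> Suc n" for T :: "unit plane_tree"
  proof (cases T)
    case (Node x ts)
    then have sum: "(\<Sum>u\<leftarrow>ts. nodes u) \<le> n"
      using T by simp
    have "nodes u \<le> n" if "u \<in> set ts" for u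
      using member_le_sum_list[of "nodes u" "map nodes ts"] that sum by force
    moreover have "length ts \<le> n"
      using length_le_sum_nodes[of ts] sum by linarith
    ultimately show ?thesis
      using Node by auto
  qed
  then have "{T :: unit plane_tree. nodes T \<le> Suc n} \<subseteq> Node () ` {ts. set ts \<subseteq> ?A \<and> length ts \<le> n}"
    by blast
  then show ?case
    using finite_lists_length_le[OF Suc.IH] finite_subset by blast
qed

lemma finite_trees_of_size: "finite (trees_of_size n)"
  using finite_nodes_le[of n] by (rule rev_finite_subset) (auto simp: trees_of_size_def)

lemma trees_of_size_nonempty:
  assumes "n \<ge> 1"
  shows "trees_of_size n \<noteq> {}"
proof -
  have "nodes (Node () (replicate (n - 1) (Node () []))) = n"
    using assms by (simp add: sum_list_replicate)
  then show ?thesis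
    unfolding trees_of_size_def by blast
qed

end

theory Submission
  imports Defs "HOL-Analysis.Analysis" "HOL-Real_Asymp.Real_Asymp"
begin

text \<open>
  A node of \<open>Sem T\<close> at depth \<open>k\<close> is an admissible sequence of \<open>k + 1\<close> actions of \<open>T\<close>. Summed over all
  plane trees of size \<open>n\<close>, these sequences are counted by a product of \<open>1 \<cdot> 3 \<cdots> (2 k - 1)\<close> and a ballot
  number, so that the mean is \<open>2 n! / 2\<^sup>n \<cdot> (\<Sum>j<n. w n j / j!)\<close> with
  \<open>w n j = (\<Prod>i<j. (2 n - 1 - i) / (2 n - 2 i - 1))\<close>, which tends to 1. The third-order expansion of \<open>w n j\<close> in
  \<open>1 / n\<close> has coefficients that are polynomials in \<open>j\<close>, and the error is at most \<open>g j / n\<^sup>4\<close> with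
  \<open>(\<Sum>j. g j / j!) < \<infinity>\<close>. In the basis of falling factorials each of the resulting series sums to
  a multiple of \<open>e\<close>; multiplying by the Stirling expansion of \<open>n!\<close> gives the claim.
\<close>

section \<open>Counting the nodes of semantic trees\<close>

definition forests :: "nat \<Rightarrow> unit plane_tree list set" where
  "forests N = {ts. (\<Sum>u\<leftarrow>ts. nodes u) = N}"

fun children :: "'a plane_tree \<Rightarrow> 'a plane_tree list" where
  "children (Node t ts) = ts"

lemma Node_children: "Node () (children T) = T"
  by (cases T) simp

lemma nodes_children: "nodes T = Suc (\<Sum>u\<leftarrow>children T. nodes u)"
  by (cases T) simp

lemma trees_of_size_Suc: "trees_of_size (Suc N) = Node () ` forests N"
proof (rule set_eqI)
  fix T :: "unit plane_tree"
  obtain ts where T: "T = Node () ts"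
    by (cases T) simp
  show "T \<in> trees_of_size (Suc N) \<longleftrightarrow> T \<in> Node () ` forests N"
    unfolding T trees_of_size_def forests_def by auto
qed

lemma inj_Node: "inj_on (Node ()) A"
  by (auto simp: inj_on_def)

lemma finite_forests: "finite (forests N)"
  using finite_trees_of_size[of "Suc N"] finite_imageD[OF _ inj_Node]
  unfolding trees_of_size_Suc by blast

lemma forests_0: "forests 0 = {[]}"
proof -
  have "ts = []" if "(\<Sum>u\<leftarrow>ts. nodes u) = 0" for ts :: "unit plane_tree list"
    using length_le_sum_nodes[of ts] that by simp
  then show ?thesis
    unfolding forests_def by auto
qed

lemma Sem_forest:
  "nodes (Sem (Node () ts)) = Suc (\<Sum>i<length ts. nodes (Sem (contract (Node () ts) i)))"
proof -
  have "nodes (Sem (Node () ts))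
      = Suc (\<Sum>i\<leftarrow>[0..<length ts]. nodes (Sem (contract (Node () ts) i)))"
    by (subst Sem.simps) (simp add: o_def)
  also have "\<dots> = Suc (\<Sum>i<length ts. nodes (Sem (contract (Node () ts) i)))"
    by (simp add: interv_sum_list_conv_sum_set_nat atLeast0LessThan)
  finally show ?thesis .
qed

lemma contract_forest:
  "contract (Node () ts) i = Node () (take i ts @ children (ts ! i) @ drop (Suc i) ts)"
  by (cases "ts ! i") simp

section \<open>Weighted sums over forests and their recursions\<close>

definition forest_sum :: "(nat \<Rightarrow> real) \<Rightarrow> nat \<Rightarrow> real" where
  "forest_sum f N = (\<Sum>ts\<in>forests N. f (length ts))"

text \<open>The weights see a forest only through its number of trees. Both recursions below turn
  such a weight into another one of this kind, so iterating them never requires finer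
  information.\<close>

definition sem_sum :: "(nat \<Rightarrow> real) \<Rightarrow> nat \<Rightarrow> real" where
  "sem_sum f N = (\<Sum>ts\<in>forests N. f (length ts) * real (nodes (Sem (Node () ts))))"

lemma forest_sum_0: "forest_sum f 0 = f 0"
  by (simp add: forest_sum_def forests_0)

text \<open>Removing the root of the first tree turns a nonempty forest into a forest with one node
  less and a marked initial segment, the former children of that root.\<close>

lemma forest_sum_Suc: "forest_sum f (Suc N) = forest_sum (\<lambda>L. \<Sum>i\<le>L. f (Suc i)) N"
proof -
  have "forest_sum f (Suc N) = (\<Sum>(ws, a)\<in>(SIGMA ws:forests N. {..length ws}). f (Suc (length ws - a)))"
    unfolding forest_sum_def
  proof (rule sum.reindex_bij_witness[where
      i = "\<lambda>(ws, a). Node () (take a ws) # drop a ws" and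
      j = "\<lambda>ts. (children (hd ts) @ tl ts, length (children (hd ts)))"])
    fix ts assume ts: "ts \<in> forests (Suc N)"
    then obtain t us where [simp]: "ts = t # us"
      by (cases ts) (auto simp: forests_def)
    show "(case (children (hd ts) @ tl ts, length (children (hd ts))) of
        (ws, a) \<Rightarrow> Node () (take a ws) # drop a ws) = ts"
      by (simp add: Node_children)
    show "(children (hd ts) @ tl ts, length (children (hd ts))) \<in> (SIGMA ws:forests N. {..length ws})"
      using ts by (auto simp: forests_def nodes_children[of t])
    show "(case (children (hd ts) @ tl ts, length (children (hd ts))) of
        (ws, a) \<Rightarrow> f (Suc (length ws - a))) = f (length ts)"
      by simp
  next
    fix p assume p: "p \<in> (SIGMA ws:forests N. {..length ws})"
    obtain ws a where [simp]: "p = (ws, a)" by (cases p)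
    have "(\<Sum>u\<leftarrow>take a ws. nodes u) + (\<Sum>u\<leftarrow>drop a ws. nodes u) = (\<Sum>u\<leftarrow>take a ws @ drop a ws. nodes u)"
      by (simp only: map_append sum_list_append)
    then show "(case p of (ws, a) \<Rightarrow> Node () (take a ws) # drop a ws) \<in> forests (Suc N)"
      using p by (simp add: forests_def)
    show "(children (hd (case p of (ws, a) \<Rightarrow> Node () (take a ws) # drop a ws)) @
          tl (case p of (ws, a) \<Rightarrow> Node () (take a ws) # drop a ws),
          length (children (hd (case p of (ws, a) \<Rightarrow> Node () (take a ws) # drop a ws)))) = p"
      using p by simp
  qed
  also have "\<dots> = (\<Sum>ws\<in>forests N. \<Sum>a\<le>length ws. f (Suc (length ws - a)))"
    by (simp add: sum.Sigma finite_forests)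
  also have "\<dots> = (\<Sum>ws\<in>forests N. \<Sum>i\<le>length ws. f (Suc i))"
  proof -
    have "(\<Sum>a\<le>L. f (Suc (L - a))) = (\<Sum>i\<le>L. f (Suc i))" for L
      by (rule sum.reindex_bij_witness[of _ "\<lambda>i. L - i" "\<lambda>i. L - i"]) auto
    then show ?thesis by simp
  qed
  finally show ?thesis
    by (simp add: forest_sum_def)
qed

text \<open>A step \<open>T \<mapsto> contract T i\<close> is inverted by marking the segment of root-subtrees that came from
  the contracted child.\<close>

lemma sem_sum_Suc:
  "sem_sum f (Suc N)
     = forest_sum f (Suc N) + sem_sum (\<lambda>L. \<Sum>i\<le>L. real (Suc i) * f (Suc i)) N"
proof -
  define s where "s ts = real (nodes (Sem (Node () ts)))" for ts
  define fill where "fill ts i = take i ts @ children (ts ! i) @ drop (Suc i) ts"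
    for ts :: "unit plane_tree list" and i
  have s: "s ts = 1 + (\<Sum>i<length ts. s (fill ts i))" for ts
    unfolding s_def fill_def contract_forest[symmetric]
    by (subst Sem_forest) (simp del: contract.simps Sem.simps)
  \<comment> \<open>Collapsing the segment from \<open>a\<close> to \<open>b\<close> of a forest of
    length \<open>L\<close> leaves length \<open>L - (b - a) + 1\<close>. The value
    \<open>i + 1\<close> arises from exactly \<open>i + 1\<close> segments, one for each start
    \<open>a \<le> i\<close>; this is the origin of the factor \<open>Suc i\<close>.\<close>
  have weight: "(\<Sum>b\<le>L. \<Sum>a\<le>b. f (Suc (L - (b - a))) * y) = (\<Sum>i\<le>L. real (Suc i) * f (Suc i)) * y" for L y
  proof -
    have "(\<Sum>b\<le>L. \<Sum>a\<le>b. f (Suc (L - (b - a)))) = (\<Sum>(b, a)\<in>(SIGMA b:{..L}. {..b}). f (Suc (L - (b - a))))"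
      by (rule sum.Sigma) auto
    also have "\<dots> = (\<Sum>(i, a)\<in>(SIGMA i:{..L}. {..i}). f (Suc i))"
      by (rule sum.reindex_bij_witness[where i = "\<lambda>(i, a). (L - i + a, a)" and j = "\<lambda>(b, a). (L - (b - a), a)"])
         auto
    also have "\<dots> = (\<Sum>i\<le>L. \<Sum>a\<le>i. f (Suc i))"
      by (rule sum.Sigma[symmetric]) auto
    also have "\<dots> = (\<Sum>i\<le>L. real (Suc i) * f (Suc i))"
      by simp
    finally show ?thesis
      by (simp only: flip: sum_distrib_right)
  qed
  let ?D = "SIGMA ts:forests (Suc N). {..<length ts}"
  let ?E = "SIGMA ws:forests N. SIGMA b:{..length ws}. {..b}"
  \<comment> \<open>Here \<open>ws\<close> is the contracted forest. The trees at positions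
    \<open>a\<close> to \<open>b - 1\<close> in it are the former children of the contracted root,
    which stood at position \<open>a\<close>.\<close>
  have "(\<Sum>(ts, i)\<in>?D. f (length ts) * s (fill ts i))
      = (\<Sum>(ws, b, a)\<in>?E. f (Suc (length ws - (b - a))) * s ws)"
  proof (rule sum.reindex_bij_witness[where
      i = "\<lambda>(ws, b, a). (take a ws @ Node () (take (b - a) (drop a ws)) # drop b ws, a)" and
      j = "\<lambda>(ts, i). (fill ts i, i + length (children (ts ! i)), i)"])
    fix p assume p: "p \<in> ?D"
    obtain ts i where [simp]: "p = (ts, i)" by (cases p)
    have i: "i < length ts" and ts: "(\<Sum>u\<leftarrow>ts. nodes u) = Suc N"
      using p by (auto simp: forests_def)
    define l t r where "l = take i ts" and "t = ts ! i" and "r = drop (Suc i) ts"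
    have e: "ts = l @ t # r" and l: "length l = i"
      unfolding l_def t_def r_def using id_take_nth_drop[OF i] i by auto
    show "(case case p of (ts, i) \<Rightarrow> (fill ts i, i + length (children (ts ! i)), i) of
        (ws, b, a) \<Rightarrow> (take a ws @ Node () (take (b - a) (drop a ws)) # drop b ws, a)) = p"
      unfolding fill_def by (simp add: e l[symmetric] Node_children)
    show "(case p of (ts, i) \<Rightarrow> (fill ts i, i + length (children (ts ! i)), i)) \<in> ?E"
      using ts unfolding fill_def forests_def
      by (simp add: e l[symmetric] nodes_children[of t])
    show "(case case p of (ts, i) \<Rightarrow> (fill ts i, i + length (children (ts ! i)), i) of
        (ws, b, a) \<Rightarrow> f (Suc (length ws - (b - a))) * s ws)
      = (case p of (ts, i) \<Rightarrow> f (length ts) * s (fill ts i))"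
      unfolding fill_def by (simp add: e l[symmetric])
  next
    fix p assume p: "p \<in> ?E"
    obtain ws b a where [simp]: "p = (ws, b, a)" by (cases p)
    have ab: "a \<le> b" "b \<le> length ws" and ws: "(\<Sum>u\<leftarrow>ws. nodes u) = N"
      using p by (auto simp: forests_def)
    define l c r where "l = take a ws" and "c = take (b - a) (drop a ws)" and "r = drop b ws"
    have "drop a ws = c @ r"
      unfolding c_def r_def using append_take_drop_id[of "b - a" "drop a ws"] ab by simp
    then have e: "ws = l @ c @ r" and l: "length l = a" and c: "length c = b - a"
      unfolding l_def c_def using append_take_drop_id[of a ws] ab by auto
    have b: "b = length l + length c"
      using ab l c by simp
    show "(case p of (ws, b, a) \<Rightarrow>
        (take a ws @ Node () (take (b - a) (drop a ws)) # drop b ws, a)) \<in> ?D"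
      using ws by (simp add: e b l[symmetric] forests_def)
    show "(case case p of (ws, b, a) \<Rightarrow>
          (take a ws @ Node () (take (b - a) (drop a ws)) # drop b ws, a) of
        (ts, i) \<Rightarrow> (fill ts i, i + length (children (ts ! i)), i)) = p"
      unfolding fill_def by (simp add: e b l[symmetric])
  qed
  also have "\<dots> = (\<Sum>ws\<in>forests N. \<Sum>b\<le>length ws. \<Sum>a\<le>b. f (Suc (length ws - (b - a))) * s ws)"
    by (simp add: sum.Sigma finite_forests del: diff_diff_right)
  also have "(\<Sum>(ts, i)\<in>?D. f (length ts) * s (fill ts i))
      = (\<Sum>ts\<in>forests (Suc N). f (length ts) * (\<Sum>i<length ts. s (fill ts i)))"
    by (simp add: sum.Sigma finite_forests sum_distrib_left)
  finally have *: "(\<Sum>ts\<in>forests (Suc N). f (length ts) * (\<Sum>i<length ts. s (fill ts i)))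
      = sem_sum (\<lambda>L. \<Sum>i\<le>L. real (Suc i) * f (Suc i)) N"
    by (simp only: sem_sum_def s_def weight)
  have "sem_sum f (Suc N) = (\<Sum>ts\<in>forests (Suc N). f (length ts) * (1 + (\<Sum>i<length ts. s (fill ts i))))"
    unfolding sem_sum_def by (simp only: s_def[symmetric] s[symmetric])
  then show ?thesis
    by (simp add: distrib_left sum.distrib * forest_sum_def)
qed

lemma sem_sum_0: "sem_sum f 0 = f 0"
  by (simp add: sem_sum_def forests_0)

section \<open>Ballot numbers\<close>

text \<open>\<open>multichoose r L\<close> counts the ways to cut a list of length \<open>L\<close> into \<open>r\<close> segments; for \<open>r = 0\<close>
  the truncated subtraction gives 1 if \<open>L = 0\<close> and 0 otherwise.\<close>

definition multichoose :: "nat \<Rightarrow> nat \<Rightarrow> real" where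
  "multichoose r L = real ((L + r - 1) choose L)"

lemma multichoose_Suc_Suc:
  "multichoose (Suc r) (Suc L) = multichoose r (Suc L) + multichoose (Suc r) L"
  by (simp add: multichoose_def)

lemma multichoose_0_right: "multichoose r 0 = 1"
  by (simp add: multichoose_def)

lemma sum_multichoose: "(\<Sum>i\<le>L. multichoose (Suc r) i) = multichoose (Suc (Suc r)) L"
  by (induction L) (simp_all add: multichoose_0_right multichoose_Suc_Suc)

lemma forest_sum_multichoose_0: "forest_sum (multichoose 0) (Suc N) = 0"
  by (subst forest_sum_Suc) (simp add: multichoose_def forest_sum_def binomial_eq_0)

text \<open>Removing the first root evaluates the weight only at positive lengths, where Pascal's
  rule splits it. The second part then sums by the hockey-stick identity.\<close>

lemma forest_sum_multichoose_rec:
  "forest_sum (multichoose (Suc r)) (Suc N)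
     = forest_sum (multichoose r) (Suc N) + forest_sum (multichoose (Suc (Suc r))) N"
  by (simp add: forest_sum_Suc multichoose_Suc_Suc sum.distrib sum_multichoose)
     (simp add: forest_sum_def sum.distrib)

text \<open>The sum counts \<open>r\<close>-tuples of forests with \<open>N + 1\<close> nodes in
  all. By Pascal's rule the difference of binomials obeys the same recursion, and at
  \<open>r = 0\<close> it vanishes by symmetry. The recursion raises \<open>r\<close> when it lowers
  \<open>N\<close>, hence an outer induction on \<open>N\<close> for all \<open>r\<close> and an
  inner one on \<open>r\<close>.\<close>

lemma forest_sum_multichoose_ballot:
  "forest_sum (multichoose r) (Suc N)
     = real ((2 * N + r + 1) choose Suc N) - real ((2 * N + r + 1) choose N)"
proof (induction N arbitrary: r)
  case 0
  show ?case
  proof (induction r)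
    case 0
    then show ?case
      by (simp add: forest_sum_multichoose_0)
  next
    case (Suc r)
    then show ?case
      by (simp add: forest_sum_multichoose_rec[of r] forest_sum_0 multichoose_0_right)
  qed
next
  case (Suc N)
  note IH = Suc.IH
  show ?case
  proof (induction r)
    case 0
    have "((2 * N + 3) choose Suc (Suc N)) = ((2 * N + 3) choose Suc N)"
      using binomial_symmetric[of "Suc N" "2 * N + 3"] by simp
    then show ?case
      by (simp add: forest_sum_multichoose_0 eval_nat_numeral)
  next
    case (Suc r)
    then show ?case
      by (simp add: forest_sum_multichoose_rec[of r] IH)
  qed
qed

text \<open>The familiar form \<open>r / (2 N + r)\<close> times a binomial, with the denominator
  multiplied out so that \<open>N = r = 0\<close> is covered. Both binomials of the difference are
  rational multiples of the one on the right.\<close>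

lemma forest_sum_multichoose:
  "real (2 * N + r) * forest_sum (multichoose r) N = real r * real ((2 * N + r) choose N)"
proof (cases N)
  case 0
  then show ?thesis
    by (simp add: forest_sum_0 multichoose_0_right)
next
  case (Suc M)
  define K where "K = 2 * M + r + 1"
  have 1: "real (Suc M) * real (Suc K choose Suc M) = real (Suc K) * real (K choose M)"
    using Suc_times_binomial_eq[of K M] by (metis of_nat_mult mult.commute)
  have "real (Suc K choose Suc M) = real (K choose M) + real (K choose Suc M)"
    by simp
  then have 2: "real (Suc K - Suc M) * real (Suc K choose Suc M) = real (Suc K) * real (K choose Suc M)"
    using 1 by (simp add: K_def algebra_simps)
  have "real (Suc K) * (real (K choose Suc M) - real (K choose M))
      = (real (Suc K - Suc M) - real (Suc M)) * real (Suc K choose Suc M)"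
    using 1 2 by (simp only: right_diff_distrib left_diff_distrib)
  also have "real (Suc K - Suc M) - real (Suc M) = real r"
    by (simp add: K_def)
  finally show ?thesis
    unfolding Suc forest_sum_multichoose_ballot by (simp add: K_def)
qed

section \<open>Total size of the semantic trees\<close>

definition odd_fact :: "nat \<Rightarrow> real" where
  "odd_fact k = (\<Prod>i<k. 2 * real i + 1)"

lemma odd_fact_Suc: "odd_fact (Suc k) = odd_fact k * (2 * real k + 1)"
  by (simp add: odd_fact_def)

text \<open>\<open>odd_fact k\<close> is the number of plane increasing trees with \<open>k + 1\<close> nodes; such a tree of first
  \<open>k + 1\<close> actions leaves \<open>2 k + 1\<close> gaps for the remaining \<open>N - k\<close> nodes.\<close>

lemma sem_sum_multichoose:
  "sem_sum (\<lambda>L. odd_fact k * multichoose (2 * k + 1) L) N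
     = (\<Sum>i\<le>N. odd_fact (k + i) * forest_sum (multichoose (2 * (k + i) + 1)) (N - i))"
proof (induction N arbitrary: k)
  case 0
  then show ?case
    by (simp add: sem_sum_0 forest_sum_0)
next
  case (Suc N)
  \<comment> \<open>Absorption turns the factor \<open>Suc i\<close> into the constant
    \<open>2 k + 1\<close>. Summation over \<open>i\<close> then raises the index once more, so the
    recursion maps the weight for \<open>k\<close> to the weight for \<open>k + 1\<close>.\<close>
  have "real (Suc i) * multichoose (2 * k + 1) (Suc i) = (2 * real k + 1) * multichoose (2 * k + 2) i" for i
  proof -
    have "Suc i * (Suc i + 2 * k choose Suc i) = (2 * k + 1) * (Suc i + 2 * k choose i)"
      using binomial_absorb_comp[of "Suc i + 2 * k" i] binomial_absorption[of i "Suc i + 2 * k"]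
      by simp
    then have "real (Suc i * (Suc i + 2 * k choose Suc i)) = real ((2 * k + 1) * (Suc i + 2 * k choose i))"
      by (rule arg_cong)
    then show ?thesis
      by (simp add: multichoose_def algebra_simps)
  qed
  then have "real (Suc i) * (odd_fact k * multichoose (2 * k + 1) (Suc i))
      = odd_fact (Suc k) * multichoose (2 * k + 2) i" for i
    by (simp add: odd_fact_Suc algebra_simps)
  moreover have "(\<Sum>i\<le>L. multichoose (2 * k + 2) i) = multichoose (2 * Suc k + 1) L" for L
    using sum_multichoose[of "2 * k + 1" L] by simp
  ultimately have "(\<Sum>i\<le>L. real (Suc i) * (odd_fact k * multichoose (2 * k + 1) (Suc i)))
      = odd_fact (Suc k) * multichoose (2 * Suc k + 1) L" for L
    by (simp flip: sum_distrib_left)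
  moreover have "forest_sum (\<lambda>L. odd_fact k * multichoose (2 * k + 1) L) (Suc N)
      = odd_fact k * forest_sum (multichoose (2 * k + 1)) (Suc N)"
    by (simp add: forest_sum_def sum_distrib_left)
  ultimately show ?case
    unfolding sem_sum_Suc
    by (simp only: Suc.IH[of "Suc k"] sum.atMost_Suc_shift) simp
qed

text \<open>The weight for \<open>k = 0\<close> is constantly 1, so the two counting results give
  the number of trees, a Catalan number, and the total size of the semantic trees. The common
  divisor \<open>2 m + 1\<close> cancels, and the factor \<open>2 k + 1\<close> of the ballot number
  extends \<open>odd_fact k\<close> to \<open>odd_fact (Suc k)\<close>.\<close>

lemma mean_sem_size_eq:
  "mean_sem_size (Suc m)
     = (\<Sum>k\<le>m. odd_fact (Suc k) * real ((2 * m + 1) choose (m - k))) / real ((2 * m + 1) choose m)"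
proof -
  have one: "multichoose 1 = (\<lambda>_. 1)"
    by (simp add: multichoose_def fun_eq_iff)
  have g: "forest_sum (multichoose (2 * k + 1)) (m - k)
      = (2 * real k + 1) * real ((2 * m + 1) choose (m - k)) / (2 * real m + 1)" if "k \<le> m" for k
  proof -
    have "2 * (m - k) + (2 * k + 1) = 2 * m + 1"
      using that by simp
    then show ?thesis
      using forest_sum_multichoose[of "m - k" "2 * k + 1"] by (simp add: field_simps)
  qed
  have "real (card (trees_of_size (Suc m))) = forest_sum (multichoose 1) m"
    by (simp add: trees_of_size_Suc card_image inj_Node forest_sum_def one[unfolded One_nat_def])
  also have "\<dots> = real ((2 * m + 1) choose m) / (2 * real m + 1)"
    using g[of 0] by simp
  finally have card: "real (card (trees_of_size (Suc m))) = \<dots>" .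
  have "(\<Sum>T\<in>trees_of_size (Suc m). real (nodes (Sem T)))
      = sem_sum (\<lambda>L. odd_fact 0 * multichoose (2 * 0 + 1) L) m"
    by (simp add: trees_of_size_Suc sum.reindex[OF inj_Node] sem_sum_def odd_fact_def one[simplified])
  also have "\<dots> = (\<Sum>k\<le>m. odd_fact k * forest_sum (multichoose (2 * k + 1)) (m - k))"
    by (subst sem_sum_multichoose) simp
  also have "\<dots> = (\<Sum>k\<le>m. odd_fact (Suc k) * real ((2 * m + 1) choose (m - k)) / (2 * real m + 1))"
    by (intro sum.cong refl, simp only: g atMost_iff odd_fact_Suc) simp
  finally show ?thesis
    unfolding mean_sem_size_def card by (simp flip: sum_divide_distrib)
qed

section \<open>Stirling expansion of the factorial\<close>

text \<open>Summing the increments telescopes to a bound \<open>t n - t m\<close> on the distance of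
  \<open>s n\<close> and \<open>s m\<close>. This makes \<open>s\<close> Cauchy, and letting
  \<open>m\<close> tend to infinity yields the rate.\<close>

lemma convergent_of_telescoping_bound:
  fixes s t :: "nat \<Rightarrow> real"
  assumes t: "t \<longlonglongrightarrow> 0"
    and st: "\<And>n. n \<ge> N \<Longrightarrow> \<bar>s n - s (Suc n)\<bar> \<le> t n - t (Suc n)"
  obtains L where "s \<longlonglongrightarrow> L" and "\<And>n. n \<ge> N \<Longrightarrow> \<bar>s n - L\<bar> \<le> t n"
proof -
  have le: "\<bar>s n - s m\<bar> \<le> t n - t m" if "N \<le> n" "n \<le> m" for n m
    using that(2)
  proof (induction rule: dec_induct)
    case (step k)
    then show ?case using st[of k] that(1) by linarith
  qed simp
  have "Cauchy s"
  proof (rule metric_CauchyI)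
    fix e :: real assume "e > 0"
    then have "eventually (\<lambda>n. dist (t n) 0 < e / 2) sequentially"
      by (intro tendstoD[OF t]) simp
    then obtain M where M: "\<And>n. n \<ge> M \<Longrightarrow> \<bar>t n\<bar> < e / 2"
      by (auto simp: eventually_at_top_linorder)
    have "dist (s m) (s n) < e" if "m \<ge> max M N" "n \<ge> max M N" for m n
    proof (cases "m \<le> n")
      case True
      then show ?thesis using le[of m n] M[of m] M[of n] that by (simp add: dist_real_def)
    next
      case False
      then show ?thesis using le[of n m] M[of m] M[of n] that by (simp add: dist_real_def)
    qed
    then show "\<exists>M. \<forall>m\<ge>M. \<forall>n\<ge>M. dist (s m) (s n) < e" by blast
  qed
  then obtain L where L: "s \<longlonglongrightarrow> L"
    using Cauchy_convergent convergent_def by blast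
  moreover have "\<bar>s n - L\<bar> \<le> t n" if "n \<ge> N" for n
  proof -
    have "(\<lambda>m. \<bar>s n - s m\<bar>) \<longlonglongrightarrow> \<bar>s n - L\<bar>"
      by (intro tendsto_intros L)
    moreover have "(\<lambda>m. t n - t m) \<longlonglongrightarrow> t n - 0"
      by (intro tendsto_intros t)
    ultimately have "\<bar>s n - L\<bar> \<le> t n - 0"
      by (rule LIMSEQ_le) (use le[OF that] in blast)
    then show ?thesis by simp
  qed
  ultimately show ?thesis by (rule that)
qed

text \<open>The logarithm of \<open>n!\<close> minus Stirling's series through
  \<open>1 / n^3\<close>, with the constant \<open>ln (2 * pi) / 2\<close> left in; that constant is
  therefore the limit.\<close>

definition stirling_log :: "nat \<Rightarrow> real" where
  "stirling_log n = ln (fact n) - (real n + 1 / 2) * ln (real n) + real n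
     - 1 / (12 * real n) + 1 / (360 * real n ^ 3)"

text \<open>The next term of Stirling's series has order \<open>n^-5\<close>, so the increments have
  order \<open>n^-6\<close>. The difference on the right has order \<open>n^-5\<close> and
  eventually exceeds them.\<close>

lemma stirling_log_diff:
  "eventually (\<lambda>n. \<bar>stirling_log n - stirling_log (Suc n)\<bar>
      \<le> 1 / real n ^ 4 - 1 / real (Suc n) ^ 4) sequentially"
proof -
  have "eventually (\<lambda>x::real. \<bar>(x + 1 / 2) * ln (1 + 1 / x) - 1 - (1 / 12) * (1 / x - 1 / (x + 1))
      + (1 / 360) * (1 / x ^ 3 - 1 / (x + 1) ^ 3)\<bar> \<le> 1 / x ^ 4 - 1 / (x + 1) ^ 4) at_top"
    by real_asymp
  then have "eventually (\<lambda>n. \<bar>(real n + 1 / 2) * ln (1 + 1 / real n) - 1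
      - (1 / 12) * (1 / real n - 1 / (real n + 1))
      + (1 / 360) * (1 / real n ^ 3 - 1 / (real n + 1) ^ 3)\<bar> \<le> 1 / real n ^ 4 - 1 / (real n + 1) ^ 4) sequentially"
    by (rule eventually_compose_filterlim[OF _ filterlim_real_sequentially])
  then show ?thesis
    using eventually_gt_at_top[of 0]
  proof eventually_elim
    case (elim n)
    have "1 + 1 / real n = (real n + 1) / real n"
      using elim(2) by (simp add: field_simps)
    then have ln1: "ln (1 + 1 / real n) = ln (real n + 1) - ln (real n)"
      using elim(2) by (simp add: ln_div)
    have ln2: "ln (fact (Suc n)) = ln (real n + 1) + ln (fact n)"
      by (simp add: ln_mult add.commute)
    have "stirling_log n - stirling_log (Suc n) = (real n + 1 / 2) * ln (1 + 1 / real n) - 1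
      - (1 / 12) * (1 / real n - 1 / (real n + 1))
      + (1 / 360) * (1 / real n ^ 3 - 1 / (real n + 1) ^ 3)"
      unfolding stirling_log_def ln1 ln2 by (simp add: algebra_simps)
    then show ?case
      using elim(1) by (simp add: add.commute)
  qed
qed

lemma ln_pochhammer_half:
  assumes "n > 0"
  shows "ln (pochhammer (1 / 2 :: real) n) = ln (fact (2 * n)) - 2 * real n * ln 2 - ln (fact n)"
proof -
  have "pochhammer (1 / 2 :: real) n = fact (2 * n) / (2 ^ (2 * n) * fact n)"
    using fact_double[of n, where 'a = real] by simp
  then show ?thesis
    by (simp add: ln_div ln_mult ln_realpow)
qed

text \<open>The constant comes from the product for Gamma at 1/2, whose value is
  \<open>sqrt pi\<close>. Up to vanishing terms its logarithm is
  \<open>2 * stirling_log n - stirling_log (2 * n) - ln 2 / 2\<close>, which tends to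
  \<open>L - ln 2 / 2\<close>.\<close>

lemma stirling_log_limit:
  assumes L: "stirling_log \<longlonglongrightarrow> L"
  shows "L = ln (2 * pi) / 2"
proof -
  have L2: "(\<lambda>n. stirling_log (2 * n)) \<longlonglongrightarrow> L"
    using L by (rule filterlim_compose) (rule mult_nat_left_at_top, simp)
  have "Gamma_series' (1 / 2 :: real) \<longlonglongrightarrow> sqrt pi"
    using Gamma_series'_LIMSEQ[of "1 / 2 :: real"] by (simp add: Gamma_one_half_real)
  then have "(\<lambda>n. ln (Gamma_series' (1 / 2 :: real) n)) \<longlonglongrightarrow> ln (sqrt pi)"
    by (rule tendsto_ln) simp
  \<comment> \<open>The explicit fractions undo the corrections inside \<open>stirling_log\<close>:
    2/12 - 1/24 = 1/8 and 2/360 - 1/2880 = 15/2880.\<close>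
  moreover have "eventually (\<lambda>n. ln (Gamma_series' (1 / 2 :: real) n)
      = 2 * stirling_log n - stirling_log (2 * n) + (1 / (8 * real n) - 15 / (2880 * real n ^ 3))
        - ln 2 / 2) sequentially"
    using eventually_gt_at_top[of 0]
  proof eventually_elim
    case (elim n)
    have f: "fact n = real n * fact (n - 1)"
      using elim by (simp add: fact_reduce)
    have "ln (fact (n - 1)) = ln (fact n) - ln (real n)"
      using elim by (simp add: f ln_mult)
    moreover have "pochhammer (1 / 2 :: real) n > 0"
      by (simp add: pochhammer_pos)
    ultimately have 1: "ln (Gamma_series' (1 / 2 :: real) n)
        = ln (fact n) - ln (real n) + ln (real n) / 2 - (ln (fact (2 * n)) - 2 * real n * ln 2 - ln (fact n))"
      using elim by (simp add: Gamma_series'_def ln_div ln_mult ln_pochhammer_half)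
    have 2: "ln (real (2 * n)) = ln 2 + ln (real n)"
      using elim by (simp add: ln_mult)
    have 3: "1 / (12 * real (2 * n)) = (1 / real n) / 24"
      "1 / (360 * real (2 * n) ^ 3) = (1 / real n ^ 3) / 2880"
      "1 / (12 * real n) = (1 / real n) / 12" "1 / (360 * real n ^ 3) = (1 / real n ^ 3) / 360"
      "1 / (8 * real n) = (1 / real n) / 8" "15 / (2880 * real n ^ 3) = 15 * (1 / real n ^ 3) / 2880"
      by (simp_all add: power_mult_distrib)
    show ?case
      unfolding stirling_log_def 1 2 3 by (simp add: algebra_simps)
  qed
  ultimately have "(\<lambda>n. 2 * stirling_log n - stirling_log (2 * n) + (1 / (8 * real n) - 15 / (2880 * real n ^ 3))
        - ln 2 / 2) \<longlonglongrightarrow> ln (sqrt pi)"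
    by (rule Lim_transform_eventually)
  moreover have "(\<lambda>n. 1 / (8 * real n) - 15 / (2880 * real n ^ 3)) \<longlonglongrightarrow> 0"
    by real_asymp
  then have "(\<lambda>n. 2 * stirling_log n - stirling_log (2 * n) + (1 / (8 * real n) - 15 / (2880 * real n ^ 3))
        - ln 2 / 2) \<longlonglongrightarrow> 2 * L - L + 0 - ln 2 / 2"
    by (intro tendsto_intros L L2)
  ultimately have "ln (sqrt pi) = 2 * L - L + 0 - ln 2 / 2"
    by (rule LIMSEQ_unique)
  then show ?thesis
    by (simp add: ln_sqrt ln_mult)
qed

definition stirling_factor :: "nat \<Rightarrow> real" where
  "stirling_factor n = fact n / (sqrt (2 * pi * real n) * (real n / exp 1) ^ n)"

lemma stirling_log_bigo: "(\<lambda>n. stirling_log n - ln (2 * pi) / 2) \<in> O(\<lambda>n. 1 / real n ^ 4)"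
proof -
  obtain N where N: "\<And>n. n \<ge> N \<Longrightarrow> \<bar>stirling_log n - stirling_log (Suc n)\<bar>
      \<le> 1 / real n ^ 4 - 1 / real (Suc n) ^ 4"
    using stirling_log_diff by (auto simp: eventually_at_top_linorder)
  have "(\<lambda>n. 1 / real n ^ 4) \<longlonglongrightarrow> 0"
    by real_asymp
  from convergent_of_telescoping_bound[OF this N]
  obtain L where L: "stirling_log \<longlonglongrightarrow> L" "\<And>n. n \<ge> N \<Longrightarrow> \<bar>stirling_log n - L\<bar> \<le> 1 / real n ^ 4"
    by blast
  show ?thesis
    using L(2) unfolding stirling_log_limit[OF L(1)]
    by (intro bigoI[of _ 1] eventually_sequentiallyI[of N]) simp
qed

text \<open>For \<open>n > 0\<close> the factor equals \<open>p n * exp (d n)\<close> with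
  \<open>d\<close> of order \<open>n^-4\<close>, so only \<open>p\<close> contributes to the
  coefficients; the last one is 1/10368 - 1/360 = -139/51840.\<close>

lemma stirling_factor_expansion:
  "(\<lambda>n. stirling_factor n - (1 + 1 / (12 * real n) + 1 / (288 * real n ^ 2) - 139 / (51840 * real n ^ 3)))
     \<in> O(\<lambda>n. 1 / real n ^ 4)"
proof -
  define d where "d n = stirling_log n - ln (2 * pi) / 2" for n
  define p where "p n = exp (1 / (12 * real n) - 1 / (360 * real n ^ 3))" for n
  have d: "d \<in> O(\<lambda>n. 1 / real n ^ 4)"
    unfolding d_def by (rule stirling_log_bigo)
  have "(\<lambda>n. 1 / real n ^ 4) \<in> o(\<lambda>_. 1)"
    by real_asymp
  with d have "d \<in> o(\<lambda>_. 1)"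
    by (rule landau_o.big_small_trans)
  then have "d \<longlonglongrightarrow> 0"
    using smalloD_tendsto by fastforce
  then have "eventually (\<lambda>n. dist (d n) 0 < 1 / 2) sequentially"
    by (rule tendstoD) simp
  then have "eventually (\<lambda>n. norm (exp (d n) - 1) \<le> 2 * norm (d n)) sequentially"
  proof eventually_elim
    case (elim n)
    have "1 + d n \<le> exp (d n)"
      by (rule exp_ge_add_one_self)
    moreover have "exp (d n) \<le> 1 + 2 * \<bar>d n\<bar>"
      using exp_bound_lemma[of "d n"] elim by simp
    ultimately show ?case
      unfolding real_norm_def by linarith
  qed
  then have "(\<lambda>n. exp (d n) - 1) \<in> O(d)"
    by (rule bigoI)
  then have e: "(\<lambda>n. exp (d n) - 1) \<in> O(\<lambda>n. 1 / real n ^ 4)"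
    using d by (rule landau_o.big_trans)
  have p: "p \<in> O(\<lambda>_. 1)"
    unfolding p_def by real_asymp
  have "eventually (\<lambda>n. p n * (exp (d n) - 1) + p n = stirling_factor n) sequentially"
    using eventually_gt_at_top[of 0]
  proof eventually_elim
    case (elim n)
    have "stirling_factor n > 0"
      using elim by (simp add: stirling_factor_def)
    moreover have "ln (stirling_factor n) = 1 / (12 * real n) - 1 / (360 * real n ^ 3) + d n"
      using elim unfolding stirling_factor_def d_def stirling_log_def
      by (simp add: ln_div ln_mult ln_realpow ln_sqrt algebra_simps add_divide_distrib)
    ultimately have "stirling_factor n = p n * exp (d n)"
      by (metis exp_add exp_ln p_def)
    then show ?case
      by (simp add: algebra_simps)
  qed
  moreover have "(\<lambda>n. p n * (exp (d n) - 1)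
      + (p n - (1 + 1 / (12 * real n) + 1 / (288 * real n ^ 2) - 139 / (51840 * real n ^ 3)))) \<in> O(\<lambda>n. 1 / real n ^ 4)"
  proof (rule sum_in_bigo)
    show "(\<lambda>n. p n * (exp (d n) - 1)) \<in> O(\<lambda>n. 1 / real n ^ 4)"
      using landau_o.big.mult[OF p e] by simp
    show "(\<lambda>n. p n - (1 + 1 / (12 * real n) + 1 / (288 * real n ^ 2) - 139 / (51840 * real n ^ 3)))
        \<in> O(\<lambda>n. 1 / real n ^ 4)"
      unfolding p_def by real_asymp
  qed
  ultimately show ?thesis
    by (subst landau_o.big.in_cong[where g = "\<lambda>n. p n * (exp (d n) - 1)
      + (p n - (1 + 1 / (12 * real n) + 1 / (288 * real n ^ 2) - 139 / (51840 * real n ^ 3)))"])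
       (auto elim!: eventually_mono)
qed

section \<open>Expansion of the normalised mean\<close>

lemma odd_fact_pos: "odd_fact k > 0"
  unfolding odd_fact_def by (intro prod_pos) auto

lemma odd_fact_fact: "odd_fact k * 2 ^ k * fact k = fact (2 * k)"
proof (induction k)
  case (Suc k)
  have "odd_fact (Suc k) * 2 ^ Suc k * fact (Suc k)
      = (2 * real k + 2) * (2 * real k + 1) * (odd_fact k * 2 ^ k * fact k)"
    by (simp add: odd_fact_Suc algebra_simps)
  also have "\<dots> = fact (2 * Suc k)"
    unfolding Suc.IH by (simp add: algebra_simps)
  finally show ?case .
qed (simp add: odd_fact_def)

text \<open>This is the term \<open>k = m\<close> of the mean, the contribution of the sequences
  through all nodes. It is factored out below.\<close>

lemma odd_fact_div_central_binomial:
  "odd_fact (Suc m) / real ((2 * m + 1) choose m) = 2 * fact (Suc m) / 2 ^ Suc m"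
proof -
  have "fact (2 * Suc m) = (2 * real m + 2) * fact (2 * m + 1)"
    by (simp add: algebra_simps)
  then have "odd_fact (Suc m) * (2 ^ Suc m * fact (Suc m)) = (2 * real m + 2) * fact (2 * m + 1)"
    using odd_fact_fact[of "Suc m"] by (simp only: mult.assoc)
  then have "odd_fact (Suc m) = (2 * real m + 2) * fact (2 * m + 1) / (2 ^ Suc m * fact (Suc m))"
    by (subst nonzero_eq_divide_eq) auto
  moreover have "real ((2 * m + 1) choose m) = fact (2 * m + 1) / (fact m * fact (Suc m))"
    by (subst binomial_fact) (simp_all add: Suc_diff_le del: fact_Suc)
  ultimately have "odd_fact (Suc m) / real ((2 * m + 1) choose m) = (2 * real m + 2) * fact m / 2 ^ Suc m"
    by (simp del: fact_Suc power_Suc)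
  also have "(2 * real m + 2) * fact m = 2 * fact (Suc m)"
    by (simp add: algebra_simps)
  finally show ?thesis .
qed

section \<open>Terms of the mean relative to the last one\<close>

definition weight :: "nat \<Rightarrow> nat \<Rightarrow> real" where
  "weight n j = (\<Prod>i<j. (2 * real n - 1 - real i) / (2 * real n - 2 * real i - 1))"

text \<open>The denominators of \<open>weight n j\<close> are the \<open>j\<close> largest factors
  of \<open>odd_fact n\<close>; the numerators, divided by \<open>j!\<close>, form a binomial
  coefficient with upper index \<open>2 n - 1\<close>.\<close>

lemma odd_fact_mult_weight:
  assumes "j < n"
  shows "odd_fact n * weight n j = odd_fact (n - j) * (\<Prod>i<j. 2 * real n - 1 - real i)"
  using assms
proof (induction j)
  case (Suc j)
  have "odd_fact (n - j) = odd_fact (n - Suc j) * (2 * real n - 2 * real j - 1)"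
    using Suc.prems odd_fact_Suc[of "n - Suc j"] by (simp add: Suc_diff_Suc of_nat_diff algebra_simps)
  moreover have "2 * real n - 2 * real j - 1 > 0"
    using Suc.prems by linarith
  moreover have "odd_fact n * weight n (Suc j) = (odd_fact n * weight n j) *
      (2 * real n - 1 - real j) / (2 * real n - 2 * real j - 1)"
    by (simp add: weight_def)
  ultimately show ?case
    using Suc by simp
qed (simp add: weight_def)

lemma odd_fact_binomial:
  assumes "j \<le> m"
  shows "odd_fact (Suc (m - j)) * real ((2 * m + 1) choose j)
    = odd_fact (Suc m) * weight (Suc m) j / fact j"
proof -
  have "real ((2 * m + 1) choose j) = (\<Prod>i<j. 2 * real (Suc m) - 1 - real i) / fact j"
    by (simp add: binomial_gbinomial gbinomial_prod_rev atLeast0LessThan algebra_simps)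
  then show ?thesis
    using odd_fact_mult_weight[of j "Suc m"] assms by (simp add: Suc_diff_le)
qed

text \<open>Single factors are unbounded: for \<open>i = n - 2\<close> the factor is
  \<open>(n + 1) / 3\<close>. The induction therefore keeps \<open>k = n - j\<close> fixed and lets
  \<open>n\<close> grow along with \<open>j\<close>.\<close>

lemma weight_le:
  assumes "j < n"
  shows "weight n j \<le> 2 ^ j"
proof -
  define k where "k = n - j"
  have "k > 0" and n: "n = k + j"
    using assms by (auto simp: k_def)
  have "odd_fact k * (\<Prod>i<j. 2 * real (k + j) - 1 - real i) \<le> 2 ^ j * odd_fact (k + j)"
  proof (induction j)
    case (Suc j)
    define F where "F j = (\<Prod>i<j. 2 * real (k + j) - 1 - real i)" for j
    \<comment> \<open>Passing from \<open>F j\<close> to \<open>F (Suc j)\<close> adds two factors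
      at the top and drops \<open>2 k + j\<close> at the bottom. The product with one extra factor
      expresses this without division.\<close>
    have "(\<Prod>i<Suc (Suc j). 2 * real (k + Suc j) - 1 - real i)
        = (2 * real k + 2 * real j + 1) * (2 * real k + 2 * real j) * F j"
      by (simp add: prod.lessThan_Suc_shift F_def algebra_simps del: prod.lessThan_Suc)
    then have "F (Suc j) * (2 * real k + real j) = (2 * real k + 2 * real j + 1) * (2 * real k + 2 * real j) * F j"
      by (simp add: F_def algebra_simps)
    then have "(odd_fact k * F (Suc j)) * (2 * real k + real j)
        = ((2 * real k + 2 * real j + 1) * (2 * real k + 2 * real j)) * (odd_fact k * F j)"
      by (simp add: mult_ac)
    also have "\<dots> \<le> ((2 * real k + 2 * real j + 1) * (2 * real k + 2 * real j)) * (2 ^ j * odd_fact (k + j))"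
      using Suc.IH unfolding F_def by (intro mult_left_mono) auto
    also have "\<dots> \<le> ((2 * real k + 2 * real j + 1) * (2 * (2 * real k + real j))) * (2 ^ j * odd_fact (k + j))"
      using odd_fact_pos[of "k + j"] by (intro mult_right_mono mult_left_mono) auto
    also have "\<dots> = (2 ^ Suc j * odd_fact (k + Suc j)) * (2 * real k + real j)"
      by (simp add: odd_fact_Suc algebra_simps)
    finally show ?case
      using \<open>k > 0\<close> unfolding F_def by (subst (asm) mult_le_cancel_right) auto
  qed simp
  then have "odd_fact n * weight n j \<le> odd_fact n * 2 ^ j"
    using odd_fact_mult_weight[OF assms] by (simp add: n mult.commute)
  then show ?thesis
    using odd_fact_pos[of n] by simp
qed

lemma weight_nonneg: "j < n \<Longrightarrow> weight n j \<ge> 0"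
  unfolding weight_def by (intro prod_nonneg divide_nonneg_nonneg) auto

section \<open>Falling factorials and the cubic Taylor polynomial\<close>

definition ffact :: "nat \<Rightarrow> nat \<Rightarrow> real" where
  "ffact m j = (\<Prod>i<m. real j - real i)"

text \<open>Since \<open>ffact (Suc m) (Suc j) = (j + 1) * ffact m j\<close>, division by the
  factorial merely shifts the series by one place, and the new term at 0 vanishes.\<close>

lemma ffact_sums: "(\<lambda>j. ffact m j / fact j) sums exp 1"
proof (induction m)
  case 0
  then show ?case
    using exp_converges[of "1::real"] by (simp add: ffact_def divide_inverse)
next
  case (Suc m)
  have "ffact (Suc m) (Suc j) = (real j + 1) * ffact m j" for j
    by (simp add: ffact_def prod.lessThan_Suc_shift add.commute del: prod.lessThan_Suc)
  moreover have "fact (Suc j) = (real j + 1) * fact j" for j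
    by (simp add: add.commute)
  ultimately have "ffact (Suc m) (Suc j) / fact (Suc j) = ffact m j / fact j" for j
    by (simp del: fact_Suc of_nat_Suc)
  then have "(\<lambda>j. ffact (Suc m) (Suc j) / fact (Suc j)) sums exp 1"
    using Suc.IH by simp
  moreover have "ffact (Suc m) 0 = 0"
    by (simp add: ffact_def prod.lessThan_Suc_shift del: prod.lessThan_Suc)
  ultimately show ?case
    by (subst (asm) sums_Suc_iff) simp
qed

text \<open>The Taylor coefficients of \<open>weight (1 / x) j\<close> at \<open>x = 0\<close>, found by iterating
  \<open>weight (1 / x) (j + 1) = weight (1 / x) j * (2 - (j + 1) x) / (2 - (2 j + 1) x)\<close> and written in
  falling factorials, which sum to \<open>e\<close> against \<open>1 / j!\<close>.\<close>

definition coeff1 :: "nat \<Rightarrow> real" where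
  "coeff1 j = ffact 2 j / 4"

definition coeff2 :: "nat \<Rightarrow> real" where
  "coeff2 j = 3 / 8 * ffact 2 j + ffact 3 j / 4 + ffact 4 j / 32"

definition coeff3 :: "nat \<Rightarrow> real" where
  "coeff3 j = 9 / 16 * ffact 2 j + ffact 3 j + 7 / 16 * ffact 4 j + ffact 5 j / 16 + ffact 6 j / 384"

definition approx :: "real \<Rightarrow> nat \<Rightarrow> real" where
  "approx x j = 1 + coeff1 j * x + coeff2 j * x ^ 2 + coeff3 j * x ^ 3"

lemmas coeff_simps = coeff1_def coeff2_def coeff3_def ffact_def

text \<open>Every falling factorial contributes \<open>e\<close>, so the coefficients just add up:
  3/8 + 1/4 + 1/32 = 21/32 and 9/16 + 1 + 7/16 + 1/16 + 1/384 = 793/384.\<close>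

lemma approx_sums:
  "(\<lambda>j. approx x j / fact j) sums (exp 1 * (1 + x / 4 + 21 / 32 * x ^ 2 + 793 / 384 * x ^ 3))"
proof -
  have "(\<lambda>j. ffact 0 j / fact j + x / 4 * (ffact 2 j / fact j)
      + x ^ 2 * (3 / 8 * (ffact 2 j / fact j) + 1 / 4 * (ffact 3 j / fact j) + 1 / 32 * (ffact 4 j / fact j))
      + x ^ 3 * (9 / 16 * (ffact 2 j / fact j) + ffact 3 j / fact j + 7 / 16 * (ffact 4 j / fact j)
          + 1 / 16 * (ffact 5 j / fact j) + 1 / 384 * (ffact 6 j / fact j)))
    sums (exp 1 + x / 4 * exp 1 + x ^ 2 * (3 / 8 * exp 1 + 1 / 4 * exp 1 + 1 / 32 * exp 1)
      + x ^ 3 * (9 / 16 * exp 1 + exp 1 + 7 / 16 * exp 1 + 1 / 16 * exp 1 + 1 / 384 * exp 1))"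
    by (intro sums_add sums_mult ffact_sums)
  also have "(\<lambda>j. ffact 0 j / fact j + x / 4 * (ffact 2 j / fact j)
      + x ^ 2 * (3 / 8 * (ffact 2 j / fact j) + 1 / 4 * (ffact 3 j / fact j) + 1 / 32 * (ffact 4 j / fact j))
      + x ^ 3 * (9 / 16 * (ffact 2 j / fact j) + ffact 3 j / fact j + 7 / 16 * (ffact 4 j / fact j)
          + 1 / 16 * (ffact 5 j / fact j) + 1 / 384 * (ffact 6 j / fact j))) = (\<lambda>j. approx x j / fact j)"
    by (simp add: fun_eq_iff approx_def coeff1_def coeff2_def coeff3_def ffact_def[of 0] field_simps)
  also have "exp 1 + x / 4 * exp 1 + x ^ 2 * (3 / 8 * exp 1 + 1 / 4 * exp 1 + 1 / 32 * exp 1)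
      + x ^ 3 * (9 / 16 * exp 1 + exp 1 + 7 / 16 * exp 1 + 1 / 16 * exp 1 + 1 / 384 * exp 1)
    = exp 1 * (1 + x / 4 + 21 / 32 * x ^ 2 + 793 / 384 * x ^ 3)"
    by (simp add: algebra_simps)
  finally show ?thesis .
qed

section \<open>Error of the cubic approximation\<close>

definition defect :: "nat \<Rightarrow> real" where
  "defect j = (2 * real j + 1) * coeff3 (Suc j) - (real j + 1) * coeff3 j"

text \<open>Inserted into the recursion for the weights, the cubic cancels through
  \<open>x^3\<close> by the choice of the coefficients; truncation leaves only the term in
  \<open>x^4\<close>.\<close>

lemma approx_step:
  "approx x j * (2 - (real j + 1) * x) - approx x (Suc j) * (2 - (2 * real j + 1) * x) = defect j * x ^ 4"
proof -
  define t where "t = real j"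
  have Suc: "real (Suc j) = t + 1"
    by (simp add: t_def)
  have 1: "2 * coeff1 j - (t + 1) - 2 * coeff1 (Suc j) + (2 * t + 1) = 0"
    unfolding coeff_simps Suc t_def[symmetric] by (simp add: eval_nat_numeral field_simps)
  have 2: "2 * coeff2 j - (t + 1) * coeff1 j - 2 * coeff2 (Suc j) + (2 * t + 1) * coeff1 (Suc j) = 0"
    unfolding coeff_simps Suc t_def[symmetric] by (simp add: eval_nat_numeral field_simps)
  have 3: "2 * coeff3 j - (t + 1) * coeff2 j - 2 * coeff3 (Suc j) + (2 * t + 1) * coeff2 (Suc j) = 0"
    unfolding coeff_simps Suc t_def[symmetric] by (simp add: eval_nat_numeral field_simps)
  have "approx x j * (2 - (t + 1) * x) - approx x (Suc j) * (2 - (2 * t + 1) * x)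
    = (2 * coeff1 j - (t + 1) - 2 * coeff1 (Suc j) + (2 * t + 1)) * x
      + (2 * coeff2 j - (t + 1) * coeff1 j - 2 * coeff2 (Suc j) + (2 * t + 1) * coeff1 (Suc j)) * x ^ 2
      + (2 * coeff3 j - (t + 1) * coeff2 j - 2 * coeff3 (Suc j) + (2 * t + 1) * coeff2 (Suc j)) * x ^ 3
      + defect j * x ^ 4"
    unfolding approx_def defect_def by (simp add: eval_nat_numeral algebra_simps flip: t_def)
  then show ?thesis
    unfolding 1 2 3 by (simp add: t_def)
qed

text \<open>The defect is a polynomial in \<open>j\<close>. The form \<open>2 * K * 4 ^ j\<close>
  fits the coming induction, where \<open>2 K + 2 K = 4 K\<close>.\<close>

lemma defect_bound: "\<exists>K\<ge>0. \<forall>j. \<bar>defect j\<bar> \<le> 2 * K * 4 ^ j"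
proof -
  have "(\<lambda>j. defect j / 4 ^ j) \<longlonglongrightarrow> 0"
    unfolding defect_def by (simp add: coeff_simps eval_nat_numeral) real_asymp
  then have "Bseq (\<lambda>j. defect j / 4 ^ j)"
    by (intro convergent_imp_Bseq convergentI)
  then obtain K where "K > 0" "\<And>j. norm (defect j / 4 ^ j) \<le> K"
    by (auto elim: BseqE)
  then have "\<bar>defect j\<bar> \<le> 2 * (K / 2) * 4 ^ j" for j
    by (simp add: field_simps)
  with \<open>K > 0\<close> show ?thesis
    by (intro exI[of _ "K / 2"]) auto
qed

text \<open>In this range each recursion step multiplies the old error by at most 2 and adds a
  defect divided by a number that is at least 1, so a bound growing like \<open>4 ^ j\<close>
  reproduces itself.\<close>

lemma weight_approx_small:
  assumes K: "K \<ge> 0" "\<And>j. \<bar>defect j\<bar> \<le> 2 * K * 4 ^ j" and "n > 0" "2 * j \<le> n + 1"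
  shows "\<bar>weight n j - approx (1 / real n) j\<bar> \<le> K * 4 ^ j / real n ^ 4"
  using assms(4)
proof (induction j)
  case 0
  then show ?case
    using K by (simp add: weight_def approx_def coeff_simps eval_nat_numeral)
next
  case (Suc j)
  define x where "x = 1 / real n"
  define den where "den = 2 - (2 * real j + 1) * x"
  define r where "r = (2 - (real j + 1) * x) / den"
  have x: "x > 0"
    using assms by (simp add: x_def)
  \<comment> \<open>The hypothesis for \<open>Suc j\<close> reads
    \<open>2 j + 2 \<le> n + 1\<close>, which is exactly what is required here.\<close>
  have jx: "(2 * real j + 1) * x \<le> 1"
    using Suc.prems assms by (simp add: x_def field_simps)
  then have den: "den \<ge> 1"
    by (simp add: den_def)
  have "(2 * real n - 1 - real j) = (2 - (real j + 1) * x) * real n"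
    "(2 * real n - 2 * real j - 1) = den * real n"
    using assms by (simp_all add: den_def x_def field_simps)
  then have w: "weight n (Suc j) = weight n j * r"
    using assms by (simp add: weight_def r_def)
  have "(real j + 1) * x \<le> (2 * real j + 1) * x"
    using x by (intro mult_right_mono) auto
  \<comment> \<open>The bound \<open>r \<le> 2\<close> is equivalent to
    \<open>(3 j + 1) x \<le> 2\<close>.\<close>
  moreover have "(3 * real j + 1) * x \<le> 2 * ((2 * real j + 1) * x)"
    using x by (simp add: algebra_simps)
  ultimately have r: "0 \<le> r" "r \<le> 2"
    using den jx by (auto simp: r_def den_def field_simps)
  have "approx x j * r - approx x (Suc j) = defect j * x ^ 4 / den"
  proof -
    have "approx x j * (2 - (real j + 1) * x) - approx x (Suc j) * den = defect j * x ^ 4"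
      using approx_step[of x j] by (simp only: den_def)
    then show ?thesis
      using den by (simp add: r_def field_simps)
  qed
  then have "weight n (Suc j) - approx x (Suc j) = (weight n j - approx x j) * r + defect j * x ^ 4 / den"
    unfolding w by (simp add: algebra_simps)
  also have "\<bar>\<dots>\<bar> \<le> \<bar>weight n j - approx x j\<bar> * r + \<bar>defect j\<bar> * x ^ 4 / den"
    using r x den by (intro order.trans[OF abs_triangle_ineq]) (simp add: abs_mult)
  also have "\<dots> \<le> (K * 4 ^ j * x ^ 4) * 2 + 2 * K * 4 ^ j * x ^ 4 / 1"
    using Suc r K x den
    by (intro add_mono mult_mono frac_le) (auto simp: x_def field_simps)
  also have "\<dots> = K * 4 ^ Suc j / real n ^ 4"
    by (simp add: x_def field_simps)
  finally show ?case
    by (simp add: x_def)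
qed

text \<open>Where the Taylor expansion is of no use, namely for \<open>n < 2 j\<close>, the trivial bounds suffice because
  then \<open>1 \<le> 16 j\<^sup>4 / n\<^sup>4\<close>.\<close>

lemma weight_approx:
  obtains g :: "nat \<Rightarrow> real" where "summable (\<lambda>j. g j / fact j)"
    and "\<And>n j. n > 0 \<Longrightarrow> \<bar>(if j < n then weight n j else 0) - approx (1 / real n) j\<bar> \<le> g j / real n ^ 4"
proof -
  obtain K where K: "K \<ge> 0" "\<And>j. \<bar>defect j\<bar> \<le> 2 * K * 4 ^ j"
    using defect_bound by blast
  define q where "q j = 1 + \<bar>coeff1 j\<bar> + \<bar>coeff2 j\<bar> + \<bar>coeff3 j\<bar>" for j
  \<comment> \<open>The first summand serves \<open>2 j \<le> n\<close>; the second is the trivial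
    bound \<open>2 ^ j + q j\<close> times a factor that compensates \<open>n^4\<close> otherwise.
    Both grow at most like \<open>5 ^ j\<close>, which is summable against
    \<open>1 / j!\<close>.\<close>
  define g where "g j = K * 4 ^ j + 16 * real j ^ 4 * (2 ^ j + q j)" for j
  have "(\<lambda>j. 4 ^ j) \<in> O(\<lambda>j. 5 ^ j :: real)" "(\<lambda>j. 16 * real j ^ 4 * 2 ^ j) \<in> O(\<lambda>j. 5 ^ j)"
    by real_asymp+
  moreover have "(\<lambda>j. 16 * real j ^ 4) \<in> O(\<lambda>j. (5 / 2) ^ j)"
    by real_asymp
  moreover have "q \<in> O(\<lambda>j. 2 ^ j)"
    unfolding q_def
  proof (intro sum_in_bigo)
    show "(\<lambda>j. \<bar>coeff1 j\<bar>) \<in> O(\<lambda>j. 2 ^ j)" "(\<lambda>j. \<bar>coeff2 j\<bar>) \<in> O(\<lambda>j. 2 ^ j)"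
      "(\<lambda>j. \<bar>coeff3 j\<bar>) \<in> O(\<lambda>j. 2 ^ j)"
      by (simp_all only: landau_o.big.abs_in_iff) (simp add: coeff_simps eval_nat_numeral, real_asymp)+
  qed real_asymp
  ultimately have "g \<in> O(\<lambda>j. 5 ^ j)"
    unfolding g_def distrib_left
    using landau_o.big.mult[of "\<lambda>j. 16 * real j ^ 4" sequentially "\<lambda>j. (5 / 2) ^ j" q "\<lambda>j. 2 ^ j"]
    by (intro sum_in_bigo) (auto simp flip: power_mult_distrib)
  then have "(\<lambda>j. g j * (1 / fact j)) \<in> O(\<lambda>j. 5 ^ j * (1 / fact j))"
    by (intro landau_o.big.mult) auto
  moreover have "summable (\<lambda>j. norm (5 ^ j * (1 / fact j) :: real))"
    using summable_exp[of "5 :: real"] by (simp add: divide_inverse mult.commute)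
  ultimately have "summable (\<lambda>j. g j * (1 / fact j))"
    by (rule summable_comparison_test_bigo[rotated])
  moreover have "\<bar>(if j < n then weight n j else 0) - approx (1 / real n) j\<bar> \<le> g j / real n ^ 4"
    if "n > 0" for n j
  proof (cases "2 * j \<le> n")
    case True
    then have "\<bar>weight n j - approx (1 / real n) j\<bar> \<le> K * 4 ^ j / real n ^ 4"
      by (intro weight_approx_small[OF K \<open>n > 0\<close>]) simp_all
    also have "\<dots> \<le> g j / real n ^ 4"
      by (intro divide_right_mono) (simp_all add: g_def q_def)
    finally show ?thesis
      using True \<open>n > 0\<close> by simp
  next
    case False
    have x: "0 \<le> 1 / real n" "1 / real n \<le> 1"
      using \<open>n > 0\<close> by auto
    have "\<bar>c * (1 / real n) ^ k\<bar> \<le> \<bar>c\<bar>" for c k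
      using mult_left_le[OF power_le_one[OF x], of "\<bar>c\<bar>"] by (simp add: abs_mult power_abs)
    from this[of "coeff1 j" 1] this[of "coeff2 j" 2] this[of "coeff3 j" 3]
    have "\<bar>approx (1 / real n) j\<bar> \<le> q j"
      unfolding approx_def q_def power_one_right by linarith
    moreover define w where "w = (if j < n then weight n j else 0)"
    then have "\<bar>w\<bar> \<le> 2 ^ j"
      using weight_le[of j n] weight_nonneg[of j n] by simp
    ultimately have "\<bar>w\<bar> + \<bar>approx (1 / real n) j\<bar> \<le> 1 * (2 ^ j + q j)"
      by (simp add: add_mono)
    then have "\<bar>w - approx (1 / real n) j\<bar> \<le> 1 * (2 ^ j + q j)"
      by (rule order.trans[OF abs_triangle_ineq4])
    also have "\<dots> \<le> (16 * real j ^ 4 / real n ^ 4) * (2 ^ j + q j)"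
    proof (rule mult_right_mono)
      have "real n ^ 4 \<le> (2 * real j) ^ 4"
        using False by (intro power_mono) auto
      then show "1 \<le> 16 * real j ^ 4 / real n ^ 4"
        using \<open>n > 0\<close> by (simp add: power_mult_distrib)
    qed (simp add: q_def)
    also have "\<dots> \<le> g j / real n ^ 4"
      using K by (simp add: g_def add_divide_distrib)
    finally show ?thesis
      by (simp only: w_def)
  qed
  ultimately show ?thesis
    by (intro that[of g]) simp_all
qed

section \<open>Termwise summation and the product of both expansions\<close>

definition weight_sum :: "nat \<Rightarrow> real" where
  "weight_sum n = (\<Sum>j<n. weight n j / fact j)"

text \<open>The termwise error is at most \<open>g j / n^4\<close> with \<open>g\<close> independent
  of \<open>n\<close>; summed against \<open>1 / j!\<close> it stays of order
  \<open>n^-4\<close>.\<close>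

lemma weight_sum_expansion:
  "(\<lambda>n. weight_sum n / exp 1 - (1 + 1 / (4 * real n) + 21 / (32 * real n ^ 2) + 793 / (384 * real n ^ 3)))
     \<in> O(\<lambda>n. 1 / real n ^ 4)"
proof -
  obtain g :: "nat \<Rightarrow> real" where g: "summable (\<lambda>j. g j / fact j)"
    and le: "\<And>n j. n > 0 \<Longrightarrow> \<bar>(if j < n then weight n j else 0) - approx (1 / real n) j\<bar> \<le> g j / real n ^ 4"
    using weight_approx by blast
  define G where "G = (\<Sum>j. g j / fact j)"
  have "norm (weight_sum n / exp 1 - (1 + 1 / (4 * real n) + 21 / (32 * real n ^ 2) + 793 / (384 * real n ^ 3)))
      \<le> G / exp 1 * norm (1 / real n ^ 4)" if "n \<ge> 1" for n
  proof -
    define P where "P = 1 + 1 / (4 * real n) + 21 / (32 * real n ^ 2) + 793 / (384 * real n ^ 3)"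
    \<comment> \<open>Extension by 0 makes the finite sum a series over all \<open>j\<close>,
      comparable term by term with that of \<open>approx\<close>.\<close>
    define w where "w j = (if j < n then weight n j else 0)" for j
    have "(\<lambda>j. w j / fact j) sums (\<Sum>j<n. w j / fact j)"
      by (rule sums_finite) (auto simp: w_def)
    also have "(\<Sum>j<n. w j / fact j) = weight_sum n"
      by (simp add: w_def weight_sum_def)
    finally have "(\<lambda>j. w j / fact j - approx (1 / real n) j / fact j) sums
        (weight_sum n - exp 1 * (1 + (1 / real n) / 4 + 21 / 32 * (1 / real n) ^ 2 + 793 / 384 * (1 / real n) ^ 3))"
      by (intro sums_diff approx_sums)
    then have s: "(\<lambda>j. (w j - approx (1 / real n) j) / fact j) sums (weight_sum n - exp 1 * P)"
      by (simp add: P_def diff_divide_distrib power_divide mult.commute)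
    have gs: "(\<lambda>j. g j / fact j * (1 / real n ^ 4)) sums (G * (1 / real n ^ 4))"
      unfolding G_def by (intro sums_mult2 summable_sums g)
    have b: "\<bar>(w j - approx (1 / real n) j) / fact j\<bar> \<le> g j / fact j * (1 / real n ^ 4)" for j
      using divide_right_mono[OF le[of n j], of "fact j"] that by (simp add: w_def mult.commute)
    have "weight_sum n - exp 1 * P \<le> G * (1 / real n ^ 4)"
      using b by (intro sums_le[OF _ s gs]) (simp only: abs_le_iff)
    moreover have "- (weight_sum n - exp 1 * P) \<le> G * (1 / real n ^ 4)"
      using b by (intro sums_le[OF _ sums_minus[OF s] gs]) (simp only: abs_le_iff)
    ultimately have "\<bar>weight_sum n - exp 1 * P\<bar> / exp 1 \<le> G * (1 / real n ^ 4) / exp 1"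
      by (intro divide_right_mono) auto
    moreover have "weight_sum n / exp 1 - P = (weight_sum n - exp 1 * P) / exp 1"
      by (simp add: diff_divide_distrib)
    ultimately show ?thesis
      unfolding P_def[symmetric] by (simp add: mult.commute)
  qed
  then show ?thesis
    by (intro bigoI[of _ "G / exp 1"] eventually_sequentiallyI[of 1])
qed

lemma mean_sem_size_weight_sum:
  assumes "n \<ge> 1"
  shows "mean_sem_size n = 2 * fact n / 2 ^ n * weight_sum n"
proof -
  obtain m where n: "n = Suc m"
    using assms by (cases n) auto
  define c where "c = odd_fact (Suc m) / real ((2 * m + 1) choose m)"
  have "(\<Sum>k\<le>m. odd_fact (Suc k) * real ((2 * m + 1) choose (m - k)))
      = (\<Sum>j\<le>m. odd_fact (Suc (m - j)) * real ((2 * m + 1) choose j))"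
    by (rule sum.reindex_bij_witness[where i = "\<lambda>j. m - j" and j = "\<lambda>k. m - k"]) auto
  also have "\<dots> = (\<Sum>j\<le>m. odd_fact (Suc m) * (weight (Suc m) j / fact j))"
    by (intro sum.cong refl) (simp only: odd_fact_binomial atMost_iff times_divide_eq_right)
  also have "\<dots> = odd_fact (Suc m) * weight_sum n"
    by (simp add: n weight_sum_def lessThan_Suc_atMost sum_distrib_left del: sum.lessThan_Suc)
  finally have "mean_sem_size n = c * weight_sum n"
    unfolding n mean_sem_size_eq c_def by simp
  then show ?thesis
    unfolding c_def odd_fact_div_central_binomial n .
qed

theorem theorem30:
  shows "\<exists>\<epsilon> :: nat \<Rightarrow> real.
           \<epsilon> \<in> O(\<lambda>n. 1 / real n ^ 4) \<and>
           (\<forall>n\<ge>1. mean_sem_size n =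
              exp 1 * sqrt (2 * pi * real n) * (real n / (2 * exp 1)) ^ n *
              (2 + 2 / (3 * real n) + 49 / (36 * real n ^ 2)
                 + 27449 / (6480 * real n ^ 3) + \<epsilon> n))"
proof -
  define pref where "pref n = exp 1 * sqrt (2 * pi * real n) * (real n / (2 * exp 1)) ^ n" for n
  define p where "p n = 2 + 2 / (3 * real n) + 49 / (36 * real n ^ 2) + 27449 / (6480 * real n ^ 3)" for n
  define s where "s n = 1 + 1 / (12 * real n) + 1 / (288 * real n ^ 2) - 139 / (51840 * real n ^ 3)" for n
  define r where "r n = 1 + 1 / (4 * real n) + 21 / (32 * real n ^ 2) + 793 / (384 * real n ^ 3)" for n
  define R where "R n = weight_sum n / exp 1" for n
  \<comment> \<open>Taking the exact remainder makes the equation hold for every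
    \<open>n \<ge> 1\<close>; what is left is its order.\<close>
  define \<epsilon> where "\<epsilon> n = 2 * stirling_factor n * R n - p n" for n
  have S: "(\<lambda>n. stirling_factor n - s n) \<in> O(\<lambda>n. 1 / real n ^ 4)"
    unfolding s_def by (rule stirling_factor_expansion)
  have R: "(\<lambda>n. R n - r n) \<in> O(\<lambda>n. 1 / real n ^ 4)"
    unfolding r_def R_def by (rule weight_sum_expansion)
  have s1: "s \<in> O(\<lambda>_. 1)" and r1: "r \<in> O(\<lambda>_. 1)"
    unfolding s_def r_def by real_asymp+
  have "(\<lambda>n. 1 / real n ^ 4) \<in> O(\<lambda>_. 1)"
    by real_asymp
  with S have "(\<lambda>n. stirling_factor n - s n) \<in> O(\<lambda>_. 1)"
    by (rule landau_o.big_trans)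
  from sum_in_bigo(1)[OF this s1] have S1: "stirling_factor \<in> O(\<lambda>_. 1)"
    by simp
  \<comment> \<open>The remainder is split as
    \<open>S R - p / 2 = S (R - r) + (S - s) r + (s r - p / 2)\<close>, where \<open>S\<close> is
    the Stirling factor and the last bracket is explicit.\<close>
  have "(\<lambda>n. stirling_factor n * (R n - r n)) \<in> O(\<lambda>n. 1 * (1 / real n ^ 4))"
    by (rule landau_o.big.mult[OF S1 R])
  moreover have "(\<lambda>n. (stirling_factor n - s n) * r n) \<in> O(\<lambda>n. (1 / real n ^ 4) * 1)"
    by (rule landau_o.big.mult[OF S r1])
  moreover have "(\<lambda>n. s n * r n - p n / 2) \<in> O(\<lambda>n. 1 / real n ^ 4)"
    unfolding s_def r_def p_def by real_asymp
  ultimately have "(\<lambda>n. stirling_factor n * (R n - r n) + (stirling_factor n - s n) * r n + (s n * r n - p n / 2))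
      \<in> O(\<lambda>n. 1 / real n ^ 4)"
    by (intro sum_in_bigo(1)) simp_all
  then have "(\<lambda>n. 2 * (stirling_factor n * (R n - r n) + (stirling_factor n - s n) * r n + (s n * r n - p n / 2)))
      \<in> O(\<lambda>n. 1 / real n ^ 4)"
    by (rule landau_o.big.cmult_in_iff[THEN iffD2, rotated]) simp
  also have "(\<lambda>n. 2 * (stirling_factor n * (R n - r n) + (stirling_factor n - s n) * r n + (s n * r n - p n / 2))) = \<epsilon>"
    by (simp add: fun_eq_iff \<epsilon>_def algebra_simps)
  finally have "\<epsilon> \<in> O(\<lambda>n. 1 / real n ^ 4)" .
  moreover have "mean_sem_size n = pref n * (p n + \<epsilon> n)" if "n \<ge> 1" for n
  proof -
    have "pref n * stirling_factor n = exp 1 * fact n / 2 ^ n"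
      using that by (simp add: pref_def stirling_factor_def power_divide power_mult_distrib)
    moreover have "pref n * (p n + \<epsilon> n) = 2 * (pref n * stirling_factor n) * R n"
      by (simp add: \<epsilon>_def)
    ultimately show ?thesis
      using mean_sem_size_weight_sum[OF that] by (simp add: R_def)
  qed
  ultimately show ?thesis
    unfolding pref_def p_def by blast
qed

end
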